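(* Let $N\ge 1$ be an integer, $0<s<1$ with $N>2s$, and $p=\frac{N+2s}{N-2s}$. Let $$w(x)=\alpha_{N,s}\left(\frac{1}{1+|x|^2}\right)^{\frac{N-2s}{2}},\qquad x\in\mathbb R^N,$$ where $\alpha_{N,s}>0$ is the constant for which $w$ solves $(-\Delta)^s w=w^{p}$ in $\mathbb R^N$. Then $w$ is nondegenerate in the following sense: every bounded function $\phi:\mathbb R^N\to\mathbb R$ solving $$(-\Delta)^s\phi = p\,w^{p-1}\phi\quad\text{in }\mathbb R^N$$ is a linear combination of the $N+1$ functions $$\frac{N-2s}{2}\,w+x\cdot\nabla w,\qquad \partial_{x_i}w,\quad 1\le i\le N.$$
   Context: For a function $f$ on $\mathbb R^N$ with enough decay, the equation $(-\Delta)^s u=f$ in $\mathbb R^N$ is understood to mean $$u(x)=\gamma_{N,s}\int_{\mathbb R^N}\frac{f(y)}{|x-y|^{N-2s}}\,dy\quad\text{for all }x\in\mathbb R^N,$$ where $\gamma_{N,s}>0$ is the constant making this the inverse of the operator with Fourier multiplier $|\xi|^{2s}$ (i.e. $|\xi|^{2s}\hat u(\xi)=\hat f(\xi)$). In particular, $\phi$ bounded solves $(-\Delta)^s\phi=p w^{p-1}\phi$ iff $\phi(x)=\gamma_{N,s}\int_{\mathbb R^N}\frac{p\,w(y)^{p-1}\phi(y)}{|x-y|^{N-2s}}dy$ for all $x\in\mathbb R^N$. *)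

theory Defs
  imports "HOL-Analysis.Analysis"
begin

text \<open>The normalising constant of the Riesz potential, i.e. of the inverse of the
operator with Fourier multiplier |xi|^(2s) in R^N (0 < s, 2s < N).\<close>
definition gamma_Ns :: "nat \<Rightarrow> real \<Rightarrow> real" where
  "gamma_Ns N s = Gamma ((real N - 2 * s) / 2) / (4 powr s * pi powr (real N / 2) * Gamma s)"

text \<open>The equation (-Delta)^s u = f in R^N, understood via the Riesz potential.\<close>
definition frac_lap_sol :: "real \<Rightarrow> ('a::euclidean_space \<Rightarrow> real) \<Rightarrow> ('a \<Rightarrow> real) \<Rightarrow> bool" where
  "frac_lap_sol s u f \<longleftrightarrow>
     (\<forall>x. u x = gamma_Ns DIM('a) s *
        (\<integral>y. f y / norm (x - y) powr (real DIM('a) - 2 * s) \<partial>lborel))"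

end

theory Submission
  imports Defs
begin

text \<open>
Put \<open>a = (N + 2s) / 2\<close> and \<open>b = (N - 2s) / 2\<close>, so that \<open>a = p b\<close>, and let \<open>sph\<close> be the inverse
stereographic projection to the unit sphere of dimension \<open>N\<close>. The span in question is
\<open>{w (v \<bullet> sph)}\<close>. Translating and dilating \<open>w\<close> gives further solutions of the nonlinear equation,
namely \<open>(1 - |\<beta>|\<^sup>2)\<^bsup>b/2\<^esup> w (1 - \<beta> \<bullet> sph)\<^bsup>-b\<^esup>\<close> for \<open>|\<beta>| < 1\<close>. Pairing their equations with
that of \<open>\<phi>\<close> yields, by symmetry of the kernel and with \<open>d\<mu> = \<phi> w\<^sup>p dx\<close>,
\<open>(1 - |\<beta>|\<^sup>2)\<^sup>s \<integral> (1 - \<beta> \<bullet> sph)\<^bsup>-a\<^esup> d\<mu> = p \<integral> (1 - \<beta> \<bullet> sph)\<^bsup>-b\<^esup> d\<mu>\<close>.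
If the moments \<open>m\<^sub>j = \<integral> (\<theta> \<bullet> sph)\<^sup>j d\<mu>\<close> with \<open>j < k\<close> vanish, comparing the leading terms for
\<open>\<beta> = t \<theta>\<close>, \<open>t \<rightarrow> 0\<close>, gives \<open>(a)\<^sub>k m\<^sub>k = p (b)\<^sub>k m\<^sub>k\<close> with rising factorials, and
\<open>(a)\<^sub>k = p (b)\<^sub>k\<close> only for \<open>k = 1\<close>. So once \<open>\<phi>\<close> is corrected by some \<open>w (v \<bullet> sph)\<close> to have
vanishing first moments, all moments vanish, and by Stone-Weierstrass \<open>\<phi> = 0\<close> almost everywhere,
hence everywhere by the integral equation.
\<close>

section \<open>Integrals and power series\<close>

text \<open>The function is dominated by a weighted series of indicators of the balls of radius
  \<open>2 ^ k\<close>. Per step the weights shrink by \<open>(1/4) powr a\<close> and the volumes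
  grow by \<open>2 ^ DIM('a)\<close>, so the hypothesis makes the series of integrals geometric with
  ratio below 1.\<close>

lemma integrable_inverse_quadratic_powr:
  fixes a :: real
  assumes "2 * a > real DIM('a)"
  shows "integrable lborel (\<lambda>x::'a::euclidean_space. (1 / (1 + norm x ^ 2)) powr a)"
proof -
  have a: "a > 0" using assms by (smt (verit) DIM_positive of_nat_0_less_iff)
  define c where "c k = (4 * (1/4) ^ k :: real) powr a" for k :: nat
  have c: "c k = 4 powr a * ((1/4) powr a) ^ k" for k
    by (simp add: c_def powr_mult powr_realpow[symmetric] powr_powr mult.commute)
  have q: "(1/4) powr a * 2 ^ DIM('a) = 2 powr (real DIM('a) - 2 * a)"
  proof -
    have "(1/4::real) powr a = (2 powr (-2)) powr a"
      by (simp add: powr_minus powr_numeral)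
    then show ?thesis
      by (simp add: powr_powr powr_realpow[symmetric] powr_add[symmetric])
  qed
  let ?f = "\<lambda>k x. c k * indicator (cball (0::'a) (2 ^ k)) x"
  have int: "integrable lborel (?f k)" for k
    by (intro integrable_mult_right integrable_real_indicator) (auto simp: emeasure_cball)
  have c_nonneg: "c k \<ge> 0" for k by (simp add: c_def)
  have c_summable: "summable c"
    unfolding c[abs_def]
    by (intro summable_mult summable_geometric)
      (use powr_less_mono2[of a "1/4" 1] a in auto)
  have sum_pt: "summable (\<lambda>k. norm (?f k x))" for x
    by (rule summable_comparison_test'[OF c_summable, of 0]) (auto simp: c_nonneg indicator_def)
  have int_val: "(\<integral>x. norm (?f k x) \<partial>lborel)
      = 4 powr a * unit_ball_vol (real DIM('a)) * (2 powr (real DIM('a) - 2 * a)) ^ k" for k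
  proof -
    have "(\<integral>x. norm (?f k x) \<partial>lborel) = (\<integral>x. ?f k x \<partial>lborel)"
      by (intro Bochner_Integration.integral_cong) (auto simp: c_nonneg indicator_def)
    also have "\<dots> = c k * (unit_ball_vol (real DIM('a)) * (2 ^ k) ^ DIM('a))"
      by (simp add: content_cball)
    also have "\<dots> = 4 powr a * unit_ball_vol (real DIM('a)) * ((1/4) powr a * 2 ^ DIM('a)) ^ k"
      by (simp add: c power_mult_distrib power_mult[symmetric] mult.commute mult.left_commute)
    finally show ?thesis by (simp only: q)
  qed
  have sum_int: "summable (\<lambda>k. \<integral>x. norm (?f k x) \<partial>lborel)"
    unfolding int_val
    by (intro summable_mult summable_geometric) (use assms in \<open>auto simp: powr_less_one\<close>)
  have "integrable lborel (\<lambda>x. \<Sum>k. ?f k x)"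
    by (rule integrable_suminf[OF int _ sum_int]) (use sum_pt in auto)
  then show ?thesis
  proof (rule Bochner_Integration.integrable_bound)
    show "AE x::'a in lborel. norm ((1 / (1 + norm x ^ 2)) powr a) \<le> norm (\<Sum>k. ?f k x)"
    proof (intro AE_I2)
      fix x :: 'a
      obtain n where "norm x \<le> 2 ^ n"
        using real_arch_pow[of 2 "norm x"] by (auto intro: less_imp_le)
      \<comment> \<open>For \<open>k > 0\<close> the least such \<open>k\<close> puts
        \<open>x\<close> outside the ball of radius \<open>2 ^ (k - 1)\<close>, where the function
        is at most \<open>c k\<close>; the factor 4 in \<open>c\<close> pays for this shift of
        index.\<close>
      then obtain k where k: "norm x \<le> 2 ^ k" "\<And>j. j < k \<Longrightarrow> \<not> norm x \<le> 2 ^ j"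
        using LeastI[of "\<lambda>k. norm x \<le> 2 ^ k"] not_less_Least[of _ "\<lambda>k. norm x \<le> 2 ^ k"] by blast
      have "1 / (1 + norm x ^ 2) \<le> 4 * (1/4) ^ k"
      proof (cases k)
        case 0
        have "1 / (1 + norm x ^ 2) \<le> 1" by (simp add: divide_le_eq_1 add_pos_nonneg)
        then show ?thesis using 0 by simp
      next
        case (Suc j)
        then have "2 ^ j \<le> norm x" using k(2)[of j] by simp
        then have "(2 ^ j) ^ 2 \<le> norm x ^ 2" by (intro power_mono) auto
        then have "4 ^ j \<le> 1 + norm x ^ 2"
          by (simp add: power_mult[symmetric] mult.commute[of j] power_mult[of _ 2 j])
        then have "1 / (1 + norm x ^ 2) \<le> 1 / 4 ^ j"
          by (intro divide_left_mono) (auto intro!: mult_pos_pos add_pos_nonneg)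
        then show ?thesis using Suc by (simp add: power_one_over)
      qed
      then have "(1 / (1 + norm x ^ 2)) powr a \<le> c k"
        unfolding c_def using a by (intro powr_mono2) auto
      also have "\<dots> = (\<Sum>i\<in>{k}. ?f i x)" using k by simp
      also have "\<dots> \<le> (\<Sum>i. ?f i x)"
        using sum_pt[of x] by (intro sum_le_suminf) (auto simp: c_nonneg indicator_def intro: summable_norm_cancel)
      finally show "norm ((1 / (1 + norm x ^ 2)) powr a) \<le> norm (\<Sum>k. ?f k x)" by simp
    qed
  qed simp
qed

lemma has_bochner_integral_lborel_affine:
  fixes f :: "'a::euclidean_space \<Rightarrow> real"
  assumes "has_bochner_integral lborel f I" "c \<noteq> 0"
  shows "has_bochner_integral lborel (\<lambda>y. f (t + c *\<^sub>R y)) (I / \<bar>c\<bar> ^ DIM('a))"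
proof -
  have [measurable]: "f \<in> borel_measurable borel"
    using assms(1) by (auto simp: has_bochner_integral_iff)
  let ?D = "density (distr lborel borel (\<lambda>x::'a. t + c *\<^sub>R x)) (\<lambda>_. ennreal (\<bar>c\<bar> ^ DIM('a)))"
  have eq: "lborel = ?D"
    using lborel_affine[OF assms(2), of t] by simp
  have "integrable ?D f" "integral\<^sup>L ?D f = I"
    using assms(1) unfolding eq[symmetric] by (auto simp: has_bochner_integral_iff)
  then have "integrable (distr lborel borel (\<lambda>x::'a. t + c *\<^sub>R x)) (\<lambda>x. \<bar>c\<bar> ^ DIM('a) *\<^sub>R f x)"
    "integral\<^sup>L (distr lborel borel (\<lambda>x::'a. t + c *\<^sub>R x)) (\<lambda>x. \<bar>c\<bar> ^ DIM('a) *\<^sub>R f x) = I"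
    by (auto simp: integrable_density integral_density simp del: real_scaleR_def integral_scaleR_right)
  then have "integrable lborel (\<lambda>y. \<bar>c\<bar> ^ DIM('a) * f (t + c *\<^sub>R y))"
    "(\<integral>y. \<bar>c\<bar> ^ DIM('a) * f (t + c *\<^sub>R y) \<partial>lborel) = I"
    by (simp_all add: integrable_distr_eq integral_distr)
  then show ?thesis
    using assms(2) by (auto simp: has_bochner_integral_iff field_simps)
qed

lemma integrable_mult_bounded:
  fixes g h :: "'a \<Rightarrow> real"
  assumes g: "integrable M g" and [measurable]: "h \<in> borel_measurable M" and bd: "\<And>x. \<bar>h x\<bar> \<le> B"
  shows "integrable M (\<lambda>x. g x * h x)"
proof (rule Bochner_Integration.integrable_bound[of _ "\<lambda>x. g x * B"])
  have "\<bar>h x\<bar> \<le> \<bar>B\<bar>" for x using bd[of x] by linarith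
  then show "AE x in M. norm (g x * h x) \<le> norm (g x * B)"
    by (intro AE_I2) (auto simp: abs_mult intro: mult_left_mono)
qed (use g in auto)

text \<open>The terms are dominated by \<open>\<bar>c k\<bar> * \<bar>g x\<bar>\<close>, whose
  integrals are summable, so sum and integral can be exchanged. It serves both the binomial and the
  exponential series.\<close>

lemma sums_integral_power_series:
  fixes g u :: "'a \<Rightarrow> real" and c :: "nat \<Rightarrow> real"
  assumes g: "integrable M g" and [measurable]: "u \<in> borel_measurable M"
    and u: "\<And>x. \<bar>u x\<bar> \<le> 1" and c: "summable (\<lambda>k. \<bar>c k\<bar>)"
  shows "(\<lambda>k. c k * (\<integral>x. g x * u x ^ k \<partial>M)) sums (\<integral>x. g x * (\<Sum>k. c k * u x ^ k) \<partial>M)"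
proof -
  have [measurable]: "g \<in> borel_measurable M" using g by auto
  have le: "\<bar>u x ^ k\<bar> \<le> 1" for x k
    using u[of x] by (simp add: power_abs power_le_one)
  have bd: "\<bar>g x * u x ^ k\<bar> \<le> \<bar>g x\<bar>" for x k
    using mult_left_mono[OF le[of x k], of "\<bar>g x\<bar>"] by (simp add: abs_mult)
  have int: "integrable M (\<lambda>x. g x * u x ^ k)" for k
    by (rule Bochner_Integration.integrable_bound[OF g]) (use bd in auto)
  have sm: "summable (\<lambda>k. \<bar>c k * u x ^ k\<bar>)" for x
    by (rule summable_comparison_test'[OF c, of 0])
      (use mult_left_mono[OF le, of "\<bar>c _\<bar>"] in \<open>auto simp: abs_mult\<close>)
  have "(\<lambda>k. \<integral>x. c k * (g x * u x ^ k) \<partial>M) sums (\<integral>x. (\<Sum>k. c k * (g x * u x ^ k)) \<partial>M)"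
  proof (rule sums_integral)
    show "integrable M (\<lambda>x. c k * (g x * u x ^ k))" for k
      using int by simp
    have "summable (\<lambda>k. norm (c k * (g x * u x ^ k)))" for x
      using summable_mult[OF sm, of "\<bar>g x\<bar>" x] by (simp add: abs_mult mult_ac)
    then show "AE x in M. summable (\<lambda>k. norm (c k * (g x * u x ^ k)))" by simp
    show "summable (\<lambda>k. \<integral>x. norm (c k * (g x * u x ^ k)) \<partial>M)"
    proof (rule summable_comparison_test'[of "\<lambda>k. \<bar>c k\<bar> * (\<integral>x. \<bar>g x\<bar> \<partial>M)" 0])
      show "summable (\<lambda>k. \<bar>c k\<bar> * (\<integral>x. \<bar>g x\<bar> \<partial>M))" using c by (rule summable_mult2)
      fix k :: nat
      have "(\<integral>x. norm (c k * (g x * u x ^ k)) \<partial>M) \<le> (\<integral>x. \<bar>c k\<bar> * \<bar>g x\<bar> \<partial>M)"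
        using g int bd by (intro integral_mono) (auto simp: abs_mult[of "c k"] intro!: mult_left_mono)
      then show "norm (\<integral>x. norm (c k * (g x * u x ^ k)) \<partial>M) \<le> \<bar>c k\<bar> * (\<integral>x. \<bar>g x\<bar> \<partial>M)"
        by simp
    qed
  qed
  moreover have "(\<Sum>k. c k * (g x * u x ^ k)) = g x * (\<Sum>k. c k * u x ^ k)" for x
    using suminf_mult[OF summable_rabs_cancel[OF sm[of x]], of "g x"] by (simp add: mult_ac)
  ultimately show ?thesis by simp
qed

text \<open>Newton's binomial series, with the signs of \<open>- a gchoose k\<close> and
  \<open>(- z) ^ k\<close> absorbed into a rising factorial.\<close>

lemma sums_pochhammer_powr:
  fixes a z :: real
  assumes "\<bar>z\<bar> < 1"
  shows "(\<lambda>k. pochhammer a k / fact k * z ^ k) sums (1 - z) powr (- a)"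
proof -
  have "(- a gchoose k) * (- z) ^ k = pochhammer a k / fact k * z ^ k" for k
  proof -
    have "(- z) ^ k = (-1) ^ k * z ^ k" by (rule power_minus)
    then show ?thesis by (simp add: gbinomial_pochhammer)
  qed
  then show ?thesis
    using gen_binomial_real[of "- z" "- a"] assms by simp
qed

lemma sums_integral_pochhammer:
  fixes g u :: "'a \<Rightarrow> real"
  assumes "integrable M g" "u \<in> borel_measurable M" "\<And>x. \<bar>u x\<bar> \<le> 1" "\<bar>t\<bar> < 1" "a > 0"
  shows "(\<lambda>k. (pochhammer a k / fact k * (\<integral>x. g x * u x ^ k \<partial>M)) * t ^ k)
           sums (\<integral>x. g x * (1 - t * u x) powr (- a) \<partial>M)"
proof -
  define c where "c k = pochhammer a k / fact k * t ^ k" for k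
  \<comment> \<open>For \<open>a > 0\<close> the rising factorials are nonnegative, so the absolute
    values of the terms form the binomial series at \<open>\<bar>t\<bar>\<close>.\<close>
  have c: "summable (\<lambda>k. \<bar>c k\<bar>)"
    using sums_pochhammer_powr[of "\<bar>t\<bar>" a] assms(4,5)
    by (simp add: c_def abs_mult power_abs pochhammer_nonneg sums_iff)
  have "(\<Sum>k. c k * u x ^ k) = (1 - t * u x) powr (- a)" for x
  proof -
    have "\<bar>t * u x\<bar> < 1"
      using mult_left_mono[OF assms(3)[of x], of "\<bar>t\<bar>"] assms(4) by (simp add: abs_mult)
    then show ?thesis
      using sums_pochhammer_powr[of "t * u x" a] by (simp add: c_def sums_iff power_mult_distrib mult_ac)
  qed
  then show ?thesis
    using sums_integral_power_series[OF assms(1-3) c] by (simp add: c_def mult_ac)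
qed

text \<open>Dividing by \<open>t ^ k\<close> and letting \<open>t\<close> tend to 0 isolates the
  coefficient of index \<open>k\<close>; the factor \<open>h\<close> tends to 1 and leaves it
  unchanged.\<close>

lemma leading_coefficient_unique:
  fixes A B :: "nat \<Rightarrow> real"
  assumes A: "\<And>t. \<bar>t\<bar> < 1 \<Longrightarrow> (\<lambda>k. A k * t ^ k) sums F t"
    and B: "\<And>t. \<bar>t\<bar> < 1 \<Longrightarrow> (\<lambda>k. B k * t ^ k) sums G t"
    and h: "(h \<longlongrightarrow> 1) (at 0)" and eq: "\<And>t. \<bar>t\<bar> < 1 \<Longrightarrow> h t * F t = G t"
    and low: "\<And>j. j < k \<Longrightarrow> A j = 0" "\<And>j. j < k \<Longrightarrow> B j = 0"
  shows "A k = B k"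
proof -
  have lim: "((\<lambda>t. F t / t ^ k) \<longlongrightarrow> A k) (at 0)"
    if A: "\<And>t. \<bar>t\<bar> < 1 \<Longrightarrow> (\<lambda>k. A k * t ^ k) sums F t" and low: "\<And>j. j < k \<Longrightarrow> A j = 0"
    for A :: "nat \<Rightarrow> real" and F
  proof -
    have "((\<lambda>t. F t / t ^ k) \<longlongrightarrow> A (0 + k)) (at 0)"
    proof (rule powser_limit_0_strong[of 1 "\<lambda>n. A (n + k)"])
      fix t :: real
      assume t: "t \<noteq> 0" "norm t < 1"
      have "(\<lambda>n. A (n + k) * t ^ (n + k)) sums (F t - (\<Sum>i<k. A i * t ^ i))"
        using sums_split_initial_segment[OF A[of t], of k] t by simp
      also have "(\<Sum>i<k. A i * t ^ i) = 0" using low by simp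
      finally have "(\<lambda>n. A (n + k) * t ^ (n + k) / t ^ k) sums (F t / t ^ k)"
        by (intro sums_divide) simp
      then show "(\<lambda>n. A (n + k) * t ^ n) sums (F t / t ^ k)"
        using t by (simp add: power_add)
    qed simp
    then show ?thesis by simp
  qed
  have "((\<lambda>t. h t * (F t / t ^ k)) \<longlongrightarrow> 1 * A k) (at 0)"
    by (intro tendsto_mult h lim[OF A low(1)])
  moreover have "\<forall>\<^sub>F t in at 0. h t * (F t / t ^ k) = G t / t ^ k"
    using eq by (auto simp: eventually_at intro!: exI[of _ 1])
  ultimately have "((\<lambda>t. G t / t ^ k) \<longlongrightarrow> A k) (at 0)"
    using Lim_transform_eventually[of "\<lambda>t. h t * (F t / t ^ k)"] by simp
  then show ?thesis
    using lim[OF B low(2)] tendsto_unique[of "at (0::real)"] by auto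
qed

lemma pochhammer_strict_mono:
  fixes a b :: real
  assumes "0 < b" "b < a" "k > 0"
  shows "pochhammer b k < pochhammer a k"
  using assms(3)
proof (induction k rule: nat_induct_non_zero)
  case (Suc k)
  then show ?case
    using assms(1,2) by (auto simp: pochhammer_Suc pochhammer_pos intro!: mult_strict_mono)
qed (use assms in auto)

section \<open>Stereographic coordinates\<close>

text \<open>The inverse of the stereographic projection from the pole \<open>(0, - 1)\<close>.\<close>

definition sph :: "'a::euclidean_space \<Rightarrow> 'a \<times> real" where
  "sph x = ((2 / (1 + norm x ^ 2)) *\<^sub>R x, (1 - norm x ^ 2) / (1 + norm x ^ 2))"

lemma one_plus_norm_sq_pos [simp]: "1 + norm x ^ 2 > (0::real)"
  by (simp add: add_pos_nonneg)

lemma one_plus_norm_sq_neq [simp]: "1 + norm x ^ 2 \<noteq> (0::real)"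
  by (metis less_irrefl one_plus_norm_sq_pos)

lemma norm_sph [simp]: "norm (sph x) = 1"
proof -
  have "norm (sph x) ^ 2 = (2 / (1 + norm x ^ 2)) ^ 2 * norm x ^ 2 + ((1 - norm x ^ 2) / (1 + norm x ^ 2)) ^ 2"
    by (simp add: sph_def norm_Pair power_mult_distrib power_divide)
  also have "\<dots> = (4 * norm x ^ 2 + (1 - norm x ^ 2) ^ 2) / (1 + norm x ^ 2) ^ 2"
    by (simp add: power_divide add_divide_distrib)
  also have "4 * norm x ^ 2 + (1 - norm x ^ 2) ^ 2 = (1 + norm x ^ 2) ^ 2"
    by (simp add: power2_eq_square algebra_simps)
  finally have "norm (sph x) ^ 2 = 1 ^ 2" by simp
  then show ?thesis by (rule power2_eq_imp_eq) auto
qed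

lemma continuous_on_sph [continuous_intros]: "continuous_on A sph"
  unfolding sph_def by (intro continuous_intros) auto

lemma borel_measurable_sph [measurable]: "sph \<in> borel_measurable borel"
  by (intro borel_measurable_continuous_onI continuous_on_sph)

lemma inj_sph: "inj sph"
proof (rule injI)
  fix x y :: 'a
  assume eq: "sph x = sph y"
  then have "(1 - norm x ^ 2) / (1 + norm x ^ 2) = (1 - norm y ^ 2) / (1 + norm y ^ 2)"
    by (simp add: sph_def)
  then have "norm x ^ 2 = norm y ^ 2" by (simp add: frac_eq_eq algebra_simps)
  then show "x = y" using eq by (simp add: sph_def)
qed

lemma abs_inner_sph_le: "\<bar>v \<bullet> sph x\<bar> \<le> norm v"
  using Cauchy_Schwarz_ineq2[of v "sph x"] by simp

lemma inner_sph_less_1: "norm v < 1 \<Longrightarrow> v \<bullet> sph x < 1"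
  using abs_inner_sph_le[of v x] by linarith

text \<open>In stereographic coordinates, the conformal factor of a translated and dilated bubble relative
to the standard one is the reciprocal of an affine function on the sphere.\<close>

lemma tilted_conformal_factor:
  fixes \<beta> :: "'a::euclidean_space \<times> real"
  assumes "norm \<beta> < 1"
  obtains z \<kappa> where "\<kappa> > 0"
    "\<And>x. 1 / (1 + norm ((1 / \<kappa>) *\<^sub>R (x - z)) ^ 2)
        = \<kappa> * sqrt (1 - norm \<beta> ^ 2) * (1 / (1 + norm x ^ 2)) / (1 - \<beta> \<bullet> sph x)"
proof -
  obtain v r where \<beta>: "\<beta> = (v, r)" by (cases \<beta>)
  have nb: "norm \<beta> ^ 2 = norm v ^ 2 + r ^ 2" by (simp add: \<beta> norm_Pair)
  have lt: "norm \<beta> ^ 2 < 1" using assms by (simp add: power_less_one_iff)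
  have "\<bar>r\<bar> \<le> norm \<beta>" by (simp add: \<beta> norm_Pair real_le_rsqrt)
  then have r: "1 + r > 0" using assms by linarith
  \<comment> \<open>These values come from completing the square in \<open>(1 + norm x ^ 2) * (1 -
    \<beta> \<bullet> sph x) = (1 + r) * norm x ^ 2 - 2 * (v \<bullet> x) + (1 - r)\<close>, which
    becomes \<open>(1 + r) * (\<kappa> ^ 2 + norm (x - z) ^ 2)\<close>.\<close>
  define \<kappa> where "\<kappa> = sqrt (1 - norm \<beta> ^ 2) / (1 + r)"
  define z where "z = (1 / (1 + r)) *\<^sub>R v"
  have \<kappa>: "\<kappa> > 0" using lt r by (simp add: \<kappa>_def)
  have \<kappa>2: "\<kappa> ^ 2 = (1 - norm \<beta> ^ 2) / (1 + r) ^ 2" using lt by (simp add: \<kappa>_def power_divide)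
  have "1 / (1 + norm ((1 / \<kappa>) *\<^sub>R (x - z)) ^ 2)
        = \<kappa> * sqrt (1 - norm \<beta> ^ 2) * (1 / (1 + norm x ^ 2)) / (1 - \<beta> \<bullet> sph x)" for x
  proof -
    define X where "X = norm x ^ 2"
    have X: "1 + X > 0" by (simp add: X_def)
    define I where "I = v \<bullet> x"
    define V where "V = norm v ^ 2"
    have d: "norm (x - z) ^ 2 = X - 2 * I / (1 + r) + V / (1 + r) ^ 2"
      unfolding X_def I_def V_def z_def
      by (simp add: power2_norm_eq_inner inner_diff inner_commute)
        (simp add: power2_eq_square diff_divide_distrib)
    have k: "\<kappa> ^ 2 = (1 - V - r ^ 2) / (1 + r) ^ 2" by (simp add: \<kappa>2 nb V_def)
    have "\<beta> \<bullet> sph x = (2 * I + r * (1 - X)) / (1 + X)"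
      by (simp add: \<beta> sph_def I_def X_def add_divide_distrib)
    moreover have "(1 + X) * (1 - J / (1 + X)) = 1 + X - J" for J
      using X by (simp add: right_diff_distrib)
    ultimately have e: "(1 + X) * (1 - \<beta> \<bullet> sph x) = (1 + X) - 2 * I - r * (1 - X)"
      by simp
    have "R * ((1 - V - (R - 1) ^ 2) / R ^ 2 + (X - 2 * I / R + V / R ^ 2)) = 2 - R + X * R - 2 * I"
      if "R > 0" for R
      using that by (simp add: field_simps power2_eq_square)
    from this[OF r] have f: "(1 + X) * (1 - \<beta> \<bullet> sph x) = (1 + r) * (\<kappa> ^ 2 + norm (x - z) ^ 2)"
      unfolding d k e by (simp add: algebra_simps)
    have g: "sqrt (1 - norm \<beta> ^ 2) = \<kappa> * (1 + r)" using r by (simp add: \<kappa>_def)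
    have pos: "\<kappa> ^ 2 + norm (x - z) ^ 2 > 0" using \<kappa> by (simp add: add_pos_nonneg)
    have "\<kappa> * sqrt (1 - norm \<beta> ^ 2) * (1 / (1 + norm x ^ 2)) / (1 - \<beta> \<bullet> sph x)
        = \<kappa> * (\<kappa> * (1 + r)) / ((1 + X) * (1 - \<beta> \<bullet> sph x))"
      by (simp add: g X_def)
    also have "\<dots> = \<kappa> ^ 2 / (\<kappa> ^ 2 + norm (x - z) ^ 2)"
      unfolding f using r by (simp add: power2_eq_square)
    also have "\<dots> = 1 / (1 + norm ((1 / \<kappa>) *\<^sub>R (x - z)) ^ 2)"
    proof -
      have "norm ((1 / \<kappa>) *\<^sub>R (x - z)) ^ 2 = norm (x - z) ^ 2 / \<kappa> ^ 2"
        by (simp only: norm_scaleR) (simp add: power_divide power_mult_distrib)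
      then show ?thesis using \<kappa> pos by (simp add: field_simps)
    qed
    finally show ?thesis ..
  qed
  then show thesis using that[OF \<kappa>] by blast
qed

section \<open>Densities determined by their moments on the sphere\<close>

text \<open>The algebra for Stone-Weierstrass. Exponentials replace polynomials because the integral
  of the exponential of a linear functional expands into moments in a single direction, so mixed
  moments never arise.\<close>

inductive_set exp_sums :: "('b::real_inner \<Rightarrow> real) set" where
  exp: "(\<lambda>\<eta>. c * exp (v \<bullet> \<eta>)) \<in> exp_sums"
| add: "f \<in> exp_sums \<Longrightarrow> g \<in> exp_sums \<Longrightarrow> (\<lambda>\<eta>. f \<eta> + g \<eta>) \<in> exp_sums"

lemma exp_sums_mult:
  assumes "f \<in> exp_sums" "g \<in> exp_sums"
  shows "(\<lambda>\<eta>. f \<eta> * g \<eta>) \<in> exp_sums"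
  using assms(1)
proof induction
  case (exp c v)
  from assms(2) show ?case
  proof induction
    case (exp d u)
    show ?case using exp_sums.exp[of "c * d" "v + u"] by (simp add: inner_add_left exp_add mult_ac)
  next
    case (add f g)
    then show ?case using exp_sums.add by (fastforce simp: distrib_left)
  qed
next
  case (add f g)
  then show ?case using exp_sums.add by (fastforce simp: distrib_right)
qed

lemma function_ring_on_exp_sums:
  fixes S :: "'b::euclidean_space set"
  assumes "compact S"
  shows "function_ring_on exp_sums S"
proof
  show "continuous_on S f" if "f \<in> exp_sums" for f :: "'b \<Rightarrow> real"
    using that by induction (auto intro!: continuous_intros)
  show "(\<lambda>_::'b. c) \<in> exp_sums" for c
    using exp_sums.exp[of c "0::'b"] by simp
  fix x y :: 'b
  assume "x \<noteq> y"
  then have "(x - y) \<bullet> x \<noteq> (x - y) \<bullet> y"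
    by (metis inner_diff_right inner_eq_zero_iff right_minus_eq)
  then show "\<exists>f\<in>exp_sums. f x \<noteq> f y"
    using exp_sums.exp[of 1 "x - y"] by (intro bexI[of _ "\<lambda>\<eta>. 1 * exp ((x - y) \<bullet> \<eta>)"]) auto
qed (use assms in \<open>auto intro: exp_sums.add exp_sums_mult\<close>)

text \<open>The signed measure with density \<open>f\<close> vanishes on closed sets by exhaustion
  with compact ones, and then on all Borel sets, since the closed sets form an intersection-stable
  generator.\<close>

lemma AE_eq_0_if_compact_integrals_0:
  fixes f :: "'a::euclidean_space \<Rightarrow> real"
  assumes f: "integrable lborel f"
    and zero: "\<And>C. compact C \<Longrightarrow> (\<integral>x. indicator C x * f x \<partial>lborel) = 0"
  shows "AE x in lborel. f x = 0"
proof -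
  have [measurable]: "f \<in> borel_measurable borel" using f by auto
  have bd: "\<bar>indicator A x * f x\<bar> \<le> \<bar>f x\<bar>" for A x
    by (auto simp: indicator_def)
  have closed: "(\<integral>x. indicator C x * f x \<partial>lborel) = 0" if "closed C" for C
  proof -
    have [measurable]: "C \<in> sets borel" using that by simp
    have "(\<lambda>n. \<integral>x. indicator (C \<inter> cball 0 (real n)) x * f x \<partial>lborel)
        \<longlonglongrightarrow> (\<integral>x. indicator C x * f x \<partial>lborel)"
    proof (rule integral_dominated_convergence[where w="\<lambda>x. \<bar>f x\<bar>"])
      show "AE x in lborel. (\<lambda>n. indicator (C \<inter> cball 0 (real n)) x * f x) \<longlonglongrightarrow> indicator C x * f x"
      proof (intro AE_I2 tendsto_eventually)
        fix x :: 'a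
        obtain m :: nat where "norm x \<le> real m" using real_arch_simple by blast
        then show "\<forall>\<^sub>F n in sequentially. indicator (C \<inter> cball 0 (real n)) x * f x = indicator C x * f x"
          by (intro eventually_sequentiallyI[of m]) (auto simp: indicator_def)
      qed
      show "(\<lambda>x. indicator (C \<inter> cball 0 (real n)) x * f x) \<in> borel_measurable lborel" for n
        using that by (intro borel_measurable_times borel_measurable_indicator) auto
    qed (use f bd in auto)
    moreover have "(\<integral>x. indicator (C \<inter> cball 0 (real n)) x * f x \<partial>lborel) = 0" for n
      using that by (intro zero closed_Int_compact) auto
    ultimately show ?thesis by (simp add: LIMSEQ_const_iff)
  qed
  have int: "integrable lborel (\<lambda>x. indicator A x * f x)" if "A \<in> sets borel" for A
    using integrable_mult_indicator[OF _ f, of A] that by simp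
  have all: "(\<integral>x. indicator A x * f x \<partial>lborel) = 0" if "A \<in> sets borel" for A
  proof -
    have "Int_stable (Collect closed :: 'a set set)" "Collect closed \<subseteq> Pow (UNIV :: 'a set)"
      "A \<in> sigma_sets UNIV (Collect closed)"
      using that by (auto simp: Int_stable_def borel_eq_closed)
    then show ?thesis
    proof (induction rule: sigma_sets_induct_disjoint)
      case (compl A)
      have A: "A \<in> sets borel" using compl by (simp add: borel_eq_closed)
      have "(\<integral>x. indicator (UNIV - A) x * f x \<partial>lborel)
          = (\<integral>x. indicator UNIV x * f x - indicator A x * f x \<partial>lborel)"
        by (intro Bochner_Integration.integral_cong) (auto simp: indicator_def)
      also have "\<dots> = 0"
        using compl.IH closed[of UNIV] int[of UNIV] int[OF A]
        by (subst Bochner_Integration.integral_diff) auto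
      finally show ?case .
    next
      case (union A)
      have A: "A i \<in> sets borel" for i using union by (auto simp: borel_eq_closed)
      have "(\<integral>x. indicator (\<Union>i. A i) x *\<^sub>R f x \<partial>lborel) = (\<Sum>i. \<integral>x. indicator (A i) x *\<^sub>R f x \<partial>lborel)"
        using lebesgue_integral_countable_add[of A lborel f] union(1) A
          integrable_mult_indicator[OF _ f, of "\<Union>i. A i"]
        by (auto simp: set_lebesgue_integral_def set_integrable_def disjoint_family_on_def)
      then show ?case using union.IH by simp
    qed (auto simp: closed)
  qed
  have "sigma_finite_measure (lborel :: 'a measure)" by (rule sigma_finite_lborel)
  then show ?thesis
    by (rule sigma_finite_measure.density_zero[OF _ f]) (use all in \<open>auto simp: set_lebesgue_integral_def\<close>)
qed

text \<open>Zero moments give zero integrals against exponentials, hence against continuous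
  functions on the sphere by uniform approximation. Tent functions around the image of a compact set
  then recover its indicator, because \<open>sph\<close> is injective.\<close>

lemma AE_eq_0_if_sph_moments_0:
  fixes f :: "'a::euclidean_space \<Rightarrow> real"
  assumes f: "integrable lborel f"
    and zero: "\<And>\<theta> k. norm \<theta> \<le> 1 \<Longrightarrow> (\<integral>x. f x * (\<theta> \<bullet> sph x) ^ k \<partial>lborel) = 0"
  shows "AE x in lborel. f x = 0"
proof (rule AE_eq_0_if_compact_integrals_0[OF f])
  have [measurable]: "f \<in> borel_measurable borel" using f by auto
  have int: "integrable lborel (\<lambda>x. f x * F (sph x))"
    if F: "continuous_on UNIV F" for F :: "'a \<times> real \<Rightarrow> real"
  proof -
    have [measurable]: "F \<in> borel_measurable borel"
      using F by (rule borel_measurable_continuous_onI)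
    have "bounded (F ` sphere 0 1)"
      by (intro compact_imp_bounded compact_continuous_image continuous_on_subset[OF F]) auto
    then obtain B where B: "\<And>x. \<bar>F (sph x)\<bar> \<le> B"
      unfolding bounded_iff by fastforce
    show ?thesis by (rule integrable_mult_bounded[OF f _ B]) measurable
  qed
  have exp_zero: "(\<integral>x. f x * exp (v \<bullet> sph x) \<partial>lborel) = 0" for v
  proof -
    \<comment> \<open>Scaling by \<open>r\<close> moves \<open>v\<close> into the unit ball, where
      the moments are known to vanish; the added 1 keeps \<open>r\<close> positive for
      \<open>v = 0\<close>.\<close>
    define r where "r = norm v + 1"
    have r: "r > 0" by (simp add: r_def add_nonneg_pos)
    define \<theta> where "\<theta> = (1 / r) *\<^sub>R v"
    have \<theta>: "norm \<theta> \<le> 1" using r by (simp add: \<theta>_def r_def)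
    define c where "c k = r ^ k / fact k" for k
    have c: "summable (\<lambda>k. \<bar>c k\<bar>)"
      using summable_exp[of r] r by (simp add: c_def inverse_eq_divide)
    have "exp (v \<bullet> sph x) = (\<Sum>k. c k * (\<theta> \<bullet> sph x) ^ k)" for x
    proof -
      have "v \<bullet> sph x = r * (\<theta> \<bullet> sph x)" using r by (simp add: \<theta>_def)
      then show ?thesis
        by (simp add: exp_def c_def power_mult_distrib inverse_eq_divide)
    qed
    moreover have "(\<lambda>k. c k * (\<integral>x. f x * (\<theta> \<bullet> sph x) ^ k \<partial>lborel))
        sums (\<integral>x. f x * (\<Sum>k. c k * (\<theta> \<bullet> sph x) ^ k) \<partial>lborel)"
      by (rule sums_integral_power_series[OF f _ _ c])
        (use \<theta> abs_inner_sph_le order_trans in \<open>auto, blast\<close>)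
    ultimately show ?thesis
      using zero[OF \<theta>] by (simp add: sums_iff)
  qed
  have exps_zero: "continuous_on UNIV g \<and> (\<integral>x. f x * g (sph x) \<partial>lborel) = 0" if "g \<in> exp_sums" for g
    using that
  proof induction
    case (exp c v)
    have "(\<integral>x. f x * (c * exp (v \<bullet> sph x)) \<partial>lborel) = (\<integral>x. c * (f x * exp (v \<bullet> sph x)) \<partial>lborel)"
      by (simp only: mult.left_commute)
    then show ?case using exp_zero[of v] by (auto intro!: continuous_intros)
  next
    case (add g h)
    then show ?case
      using int[of g] int[of h] by (auto simp: distrib_left intro!: continuous_intros)
  qed
  interpret R: function_ring_on exp_sums "sphere (0::'a \<times> real) 1"
    by (rule function_ring_on_exp_sums) auto
  have cont_zero: "(\<integral>x. f x * F (sph x) \<partial>lborel) = 0" if F: "continuous_on UNIV F" for F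
  proof -
    let ?I = "\<integral>x. \<bar>f x\<bar> \<partial>lborel"
    have "\<bar>\<integral>x. f x * F (sph x) \<partial>lborel\<bar> \<le> e * ?I" if e: "e > 0" for e
    proof -
      obtain g where g: "g \<in> exp_sums" "\<And>\<eta>. \<eta> \<in> sphere 0 1 \<Longrightarrow> \<bar>F \<eta> - g \<eta>\<bar> < e"
        using R.Stone_Weierstrass_basic[OF continuous_on_subset[OF F] e] by auto
      have g': "continuous_on UNIV g" "(\<integral>x. f x * g (sph x) \<partial>lborel) = 0"
        using exps_zero[OF g(1)] by auto
      have "(\<integral>x. f x * F (sph x) \<partial>lborel) = (\<integral>x. f x * F (sph x) - f x * g (sph x) \<partial>lborel)"
        using int[OF F] int[OF g'(1)] g'(2) by simp
      also have "\<bar>\<dots>\<bar> \<le> (\<integral>x. \<bar>f x * F (sph x) - f x * g (sph x)\<bar> \<partial>lborel)"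
        by (rule integral_abs_bound)
      also have "\<dots> \<le> (\<integral>x. e * \<bar>f x\<bar> \<partial>lborel)"
      proof (rule integral_mono)
        show "\<bar>f x * F (sph x) - f x * g (sph x)\<bar> \<le> e * \<bar>f x\<bar>" for x
          using mult_left_mono[OF less_imp_le[OF g(2)[of "sph x"]], of "\<bar>f x\<bar>"]
          by (simp add: right_diff_distrib[symmetric] abs_mult mult.commute)
      qed (use int[OF F] int[OF g'(1)] f in auto)
      finally show ?thesis by simp
    qed
    note le = this
    have "?I \<ge> 0" by simp
    have "\<bar>\<integral>x. f x * F (sph x) \<partial>lborel\<bar> \<le> 0 + e" if e: "e > 0" for e
    proof -
      \<comment> \<open>Dividing by \<open>?I + 1\<close> instead of \<open>?I\<close> covers the
        case of vanishing \<open>?I\<close>.\<close>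
      have "\<bar>\<integral>x. f x * F (sph x) \<partial>lborel\<bar> \<le> e / (?I + 1) * ?I"
        using e \<open>?I \<ge> 0\<close> by (intro le divide_pos_pos add_nonneg_pos) auto
      also have "\<dots> \<le> e" using e \<open>?I \<ge> 0\<close> by (simp add: divide_le_eq add_nonneg_pos)
      finally show ?thesis by simp
    qed
    then have "\<bar>\<integral>x. f x * F (sph x) \<partial>lborel\<bar> \<le> 0" by (rule field_le_epsilon)
    then show ?thesis by simp
  qed
  fix C :: "'a set"
  assume "compact C"
  show "(\<integral>x. indicator C x * f x \<partial>lborel) = 0"
  \<comment> \<open>The distance \<open>infdist\<close> to the empty set is 0 by convention, so the
    tent functions below would be constantly 1 for empty \<open>C\<close>.\<close>
  proof (cases "C = {}")
    case False
    define K where "K = sph ` C"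
    have K: "closed K" "K \<noteq> {}"
      using \<open>compact C\<close> False
      by (auto simp: K_def intro!: compact_imp_closed compact_continuous_image continuous_on_sph)
    have [measurable]: "C \<in> sets borel" using \<open>compact C\<close> by (simp add: borel_compact)
    \<comment> \<open>For \<open>n > 0\<close>, \<open>F n\<close> is 1 on \<open>K\<close> and
      vanishes at distance at least \<open>1 / n\<close> from it; as \<open>K\<close> is closed, the
      pointwise limit is its indicator.\<close>
    define F where "F n \<eta> = max 0 (1 - real n * infdist \<eta> K)" for n \<eta>
    have F_cont: "continuous_on UNIV (F n)" for n
      unfolding F_def by (intro continuous_intros)
    have [measurable]: "F n \<in> borel_measurable borel" for n
      using F_cont by (rule borel_measurable_continuous_onI)
    have F01: "\<bar>F n \<eta>\<bar> \<le> 1" for n \<eta> by (auto simp: F_def infdist_nonneg)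
    have "(\<lambda>n. \<integral>x. f x * F n (sph x) \<partial>lborel) \<longlonglongrightarrow> (\<integral>x. indicator C x * f x \<partial>lborel)"
    proof (rule integral_dominated_convergence[where w="\<lambda>x. \<bar>f x\<bar>"])
      show "AE x in lborel. (\<lambda>n. f x * F n (sph x)) \<longlonglongrightarrow> indicator C x * f x"
      proof (intro AE_I2)
        fix x
        have mem: "sph x \<in> K \<longleftrightarrow> x \<in> C" unfolding K_def using inj_sph by (rule inj_image_mem_iff)
        have "\<forall>\<^sub>F n in sequentially. f x * F n (sph x) = indicator C x * f x"
        proof (cases "x \<in> C")
          case True
          then show ?thesis using mem by (simp add: F_def)
        next
          case False
          then have d: "infdist (sph x) K > 0"
            using mem K in_closed_iff_infdist_zero[of K "sph x"] infdist_nonneg[of "sph x" K] by auto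
          obtain m :: nat where m: "1 / infdist (sph x) K \<le> real m" using real_arch_simple by blast
          have "F n (sph x) = 0" if "n \<ge> m" for n
          proof -
            have "1 / infdist (sph x) K \<le> real n" using m that by linarith
            then show ?thesis using d by (simp add: F_def field_simps)
          qed
          then show ?thesis
            using False by (intro eventually_sequentiallyI[of m]) auto
        qed
        then show "(\<lambda>n. f x * F n (sph x)) \<longlonglongrightarrow> indicator C x * f x"
          by (rule tendsto_eventually)
      qed
      show "AE x in lborel. norm (f x * F n (sph x)) \<le> \<bar>f x\<bar>" for n
        using mult_left_mono[OF F01, of "\<bar>f _\<bar>"] by (auto simp: abs_mult)
    qed (use f in auto)
    then show ?thesis using cont_zero[OF F_cont] by (simp add: LIMSEQ_const_iff)
  qed simp
qed

section \<open>Bubbles and the linearized equation\<close>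

locale bubble =
  fixes s \<alpha> p :: real and w :: "'a::euclidean_space \<Rightarrow> real"
  assumes s_pos: "0 < s" and dim_gt: "real DIM('a) > 2 * s"
    and p_eq: "p = (real DIM('a) + 2 * s) / (real DIM('a) - 2 * s)"
    and \<alpha>_pos: "\<alpha> > 0"
    and w_eq: "\<And>x. w x = \<alpha> * (1 / (1 + norm x ^ 2)) powr ((real DIM('a) - 2 * s) / 2)"
    and w_sol: "frac_lap_sol s w (\<lambda>y. w y powr p)"
begin

definition a :: real where "a = (real DIM('a) + 2 * s) / 2"
definition b :: real where "b = (real DIM('a) - 2 * s) / 2"
text \<open>The Riesz kernel enters as a denominator. On the diagonal \<open>ker\<close> is 0 and
  division by it gives 0 by convention, which affects only a null set.\<close>

definition ker :: "'a \<Rightarrow> 'a \<Rightarrow> real" where "ker x y = norm (x - y) powr (2 * b)"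
definition \<gamma> :: real where "\<gamma> = gamma_Ns DIM('a) s"

lemma b_pos: "b > 0" and b_less_a: "b < a" and a_pos: "a > 0" and pb: "p * b = a" and p_gt_1: "p > 1"
  and a_minus_b: "a - b = 2 * s" and a_plus_b: "a + b = real DIM('a)"
  using s_pos dim_gt by (auto simp: a_def b_def p_eq field_simps)

lemma frac_lap_sol_iff: "frac_lap_sol s u f \<longleftrightarrow> (\<forall>x. u x = \<gamma> * (\<integral>y. f y / ker x y \<partial>lborel))"
proof -
  have "2 * b = real DIM('a) - 2 * s" by (simp add: b_def)
  then show ?thesis by (simp add: frac_lap_sol_def \<gamma>_def ker_def)
qed

lemma w_eq': "w x = \<alpha> * (1 / (1 + norm x ^ 2)) powr b"
  by (simp add: w_eq b_def)

lemma w_pos: "w x > 0"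
  using \<alpha>_pos by (simp add: w_eq')

lemma w_le: "w x \<le> \<alpha>"
proof -
  have "(1 / (1 + norm x ^ 2)) powr b \<le> 1"
    using b_pos by (intro powr_le1) (auto simp: divide_le_eq_1)
  then show ?thesis using \<alpha>_pos by (simp add: w_eq')
qed

lemma w_powr_p: "w x powr p = \<alpha> powr p * (1 / (1 + norm x ^ 2)) powr a"
  using \<alpha>_pos by (simp add: w_eq' powr_mult powr_powr pb mult.commute)

lemma w_powr_diff: "w x powr (p - 1) = w x powr p / w x"
  using w_pos[of x] by (simp add: powr_diff)

lemma w_measurable [measurable]: "w \<in> borel_measurable borel"
  unfolding w_eq'[abs_def] by measurable

lemma ker_measurable [measurable]: "(\<lambda>(x, y). ker x y) \<in> borel_measurable (borel \<Otimes>\<^sub>M borel)"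
  unfolding ker_def by measurable

lemma ker_commute: "ker x y = ker y x"
  by (simp add: ker_def norm_minus_commute)

lemma ker_nonneg: "ker x y \<ge> 0"
  by (simp add: ker_def)

lemma integrable_w_powr_p: "integrable lborel (\<lambda>x. w x powr p)"
  unfolding w_powr_p[abs_def]
  by (intro integrable_mult_right integrable_inverse_quadratic_powr) (use s_pos in \<open>simp add: a_def\<close>)

text \<open>Both facts follow from \<open>w > 0\<close>. The integral is nonnegative and its product
  with \<open>\<gamma>\<close> is positive, so \<open>\<gamma> > 0\<close>; and it cannot be 0, the
  default value for a non-integrable function, so the integrand is integrable.\<close>

lemma \<gamma>_pos: "\<gamma> > 0"
  and riesz_w: "has_bochner_integral lborel (\<lambda>y. w y powr p / ker x y) (w x / \<gamma>)"
proof -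
  have eq: "w x = \<gamma> * (\<integral>y. w y powr p / ker x y \<partial>lborel)" for x
    using w_sol unfolding frac_lap_sol_iff by blast
  have "(\<integral>y. w y powr p / ker 0 y \<partial>lborel) \<ge> 0"
    by (intro integral_nonneg_AE) (simp add: ker_nonneg)
  moreover have "\<gamma> * (\<integral>y. w y powr p / ker 0 y \<partial>lborel) > 0"
    using w_pos[of 0] by (simp only: eq[symmetric])
  ultimately show "\<gamma> > 0"
    by (simp add: zero_less_mult_iff)
  then have "(\<integral>y. w y powr p / ker x y \<partial>lborel) = w x / \<gamma>" by (simp add: eq[of x])
  moreover have "integrable lborel (\<lambda>y. w y powr p / ker x y)"
    using calculation w_pos[of x] \<open>\<gamma> > 0\<close> not_integrable_integral_eq[of lborel "\<lambda>y. w y powr p / ker x y"] by auto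
  ultimately show "has_bochner_integral lborel (\<lambda>y. w y powr p / ker x y) (w x / \<gamma>)"
    by (simp add: has_bochner_integral_iff)
qed

text \<open>The equation of \<open>w\<close> is transported by the translation and dilation found in
  \<open>tilted_conformal_factor\<close>. The powers of \<open>\<kappa>\<close> cancel because
  \<open>a + b\<close> is the dimension, and \<open>1 - norm \<beta> ^ 2\<close> is left with
  exponent \<open>(b - a) / 2 = - s\<close>.\<close>

lemma riesz_tilted:
  fixes \<beta> :: "'a \<times> real"
  assumes \<beta>: "norm \<beta> < 1"
  shows "has_bochner_integral lborel (\<lambda>y. w y powr p * (1 - \<beta> \<bullet> sph y) powr (- a) / ker x y)
           ((1 - norm \<beta> ^ 2) powr (- s) * w x * (1 - \<beta> \<bullet> sph x) powr (- b) / \<gamma>)"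
proof -
  obtain z \<kappa> where \<kappa>: "\<kappa> > 0" and conf: "\<And>x. 1 / (1 + norm ((1 / \<kappa>) *\<^sub>R (x - z)) ^ 2)
        = \<kappa> * sqrt (1 - norm \<beta> ^ 2) * (1 / (1 + norm x ^ 2)) / (1 - \<beta> \<bullet> sph x)"
    using tilted_conformal_factor[OF \<beta>] by blast
  define D where "D = 1 - norm \<beta> ^ 2"
  have D: "D > 0" using \<beta> by (simp add: D_def power_less_one_iff)
  define T where "T x = (1 / \<kappa>) *\<^sub>R (x - z)" for x
  have powr_T: "(1 / (1 + norm (T x) ^ 2)) powr c
      = \<kappa> powr c * D powr (c / 2) * ((1 / (1 + norm x ^ 2)) powr c * (1 - \<beta> \<bullet> sph x) powr (- c))" for x c
  proof -
    have half: "sqrt D powr c = D powr (c / 2)"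
      using D by (simp add: powr_half_sqrt[symmetric] powr_powr)
    have "(\<kappa> * sqrt D * A / q) powr c = \<kappa> powr c * D powr (c / 2) * (A powr c * q powr (- c))"
      if "A > 0" "q > 0" for A q
      using \<kappa> D that by (simp add: powr_mult powr_divide powr_minus_divide half)
    from this[of "1 / (1 + norm x ^ 2)" "1 - \<beta> \<bullet> sph x"] show ?thesis
      using inner_sph_less_1[OF \<beta>, of x] by (simp only: T_def conf D_def[symmetric]) auto
  qed
  have wT: "w (T x) = \<kappa> powr b * D powr (b / 2) * (w x * (1 - \<beta> \<bullet> sph x) powr (- b))" for x
    unfolding w_eq' powr_T by simp
  have wpT: "w (T x) powr p = \<kappa> powr a * D powr (a / 2) * (w x powr p * (1 - \<beta> \<bullet> sph x) powr (- a))" for x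
    unfolding w_powr_p powr_T by simp
  have kerT: "ker (T x) (T y) = \<kappa> powr (- 2 * b) * ker x y" for x y
  proof -
    have "T x - T y = (1 / \<kappa>) *\<^sub>R (x - y)" by (simp add: T_def algebra_simps)
    then show ?thesis using \<kappa> by (simp add: ker_def powr_divide powr_minus_divide)
  qed
  have "has_bochner_integral lborel (\<lambda>y. w (T y) powr p / ker (T x) (T y)) (w (T x) / \<gamma> / (1 / \<kappa>) ^ DIM('a))"
    using has_bochner_integral_lborel_affine[OF riesz_w[of "T x"], of "1 / \<kappa>" "- (1 / \<kappa>) *\<^sub>R z"] \<kappa>
    by (simp add: T_def[abs_def] algebra_simps)
  \<comment> \<open>The multiplier removes the constants that \<open>wpT\<close> and
    \<open>kerT\<close> put into the integrand.\<close>
  then have "has_bochner_integral lborel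
      (\<lambda>y. (\<kappa> powr (- a) * D powr (- a / 2) * \<kappa> powr (- 2 * b)) * (w (T y) powr p / ker (T x) (T y)))
      ((\<kappa> powr (- a) * D powr (- a / 2) * \<kappa> powr (- 2 * b)) * (w (T x) / \<gamma> / (1 / \<kappa>) ^ DIM('a)))"
    by (intro has_bochner_integral_mult_right) auto
  moreover have "(\<kappa> powr (- a) * D powr (- a / 2) * \<kappa> powr (- 2 * b)) * (w (T y) powr p / ker (T x) (T y))
      = w y powr p * (1 - \<beta> \<bullet> sph y) powr (- a) / ker x y" for y
    unfolding wpT kerT using \<kappa> D by (simp add: powr_minus field_simps)
  moreover have "(\<kappa> powr (- a) * D powr (- a / 2) * \<kappa> powr (- 2 * b)) * (w (T x) / \<gamma> / (1 / \<kappa>) ^ DIM('a))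
      = D powr (- s) * w x * (1 - \<beta> \<bullet> sph x) powr (- b) / \<gamma>"
  proof -
    have K: "(1 / \<kappa>) ^ DIM('a) = \<kappa> powr (- (a + b))"
      using \<kappa> by (simp add: a_plus_b powr_minus powr_realpow power_one_over inverse_eq_divide)
    have \<kappa>3: "\<kappa> powr (- a) * \<kappa> powr (- 2 * b) * \<kappa> powr b = \<kappa> powr (- (a + b))"
      by (simp add: powr_add[symmetric] algebra_simps)
    have D2: "D powr (- a / 2) * D powr (b / 2) = D powr (- s)"
      using a_minus_b by (simp add: powr_add[symmetric] field_simps)
    have "(\<kappa> powr (- a) * D powr (- a / 2) * \<kappa> powr (- 2 * b)) * (w (T x) / \<gamma> / (1 / \<kappa>) ^ DIM('a))
        = (\<kappa> powr (- a) * \<kappa> powr (- 2 * b) * \<kappa> powr b) * (D powr (- a / 2) * D powr (b / 2))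
          * (w x * (1 - \<beta> \<bullet> sph x) powr (- b)) / \<gamma> / \<kappa> powr (- (a + b))"
      unfolding wT K by (simp add: mult_ac)
    then show ?thesis
      unfolding \<kappa>3 D2 using \<kappa> by (simp add: mult_ac)
  qed
  ultimately show ?thesis by (simp add: D_def)
qed

section \<open>The linearized equation tested against tilted bubbles\<close>

lemma integrable_bounded_mult_w_powr_p:
  assumes [measurable]: "g \<in> borel_measurable borel" and bd: "\<And>x. \<bar>g x\<bar> \<le> C"
  shows "integrable lborel (\<lambda>x. g x * w x powr p)"
  using integrable_mult_bounded[OF integrable_w_powr_p _ bd] by (simp add: mult.commute)

definition linearized_sol :: "('a \<Rightarrow> real) \<Rightarrow> bool" where
  "linearized_sol \<phi> \<longleftrightarrow> frac_lap_sol s \<phi> (\<lambda>y. p * w y powr (p - 1) * \<phi> y)"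

lemma linearized_sol_iff:
  "linearized_sol \<phi> \<longleftrightarrow> (\<forall>x. \<phi> x = \<gamma> * (\<integral>y. p * w y powr (p - 1) * \<phi> y / ker x y \<partial>lborel))"
  by (simp add: linearized_sol_def frac_lap_sol_iff)

lemma abs_tilt_powr_le:
  assumes "norm \<beta> < 1" "c > 0"
  shows "\<bar>(1 - \<beta> \<bullet> sph x) powr (- c)\<bar> \<le> (1 - norm \<beta>) powr (- c)"
proof -
  have "1 - norm \<beta> \<le> 1 - \<beta> \<bullet> sph x" using abs_inner_sph_le[of \<beta> x] by linarith
  then show ?thesis using assms by (auto intro: powr_mono2')
qed

text \<open>\<open>H\<close> is integrated in both orders. Over \<open>y\<close> first, the equation
  of \<open>\<phi>\<close> applies after swapping the arguments of the symmetric kernel; over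
  \<open>x\<close> first, \<open>riesz_tilted\<close> applies.\<close>

lemma linearized_sol_tilted:
  fixes \<beta> :: "'a \<times> real"
  assumes [measurable]: "\<phi> \<in> borel_measurable borel" and bd: "\<And>x. \<bar>\<phi> x\<bar> \<le> C"
    and sol: "linearized_sol \<phi>" and \<beta>: "norm \<beta> < 1"
  shows "(1 - norm \<beta> ^ 2) powr s * (\<integral>x. \<phi> x * w x powr p * (1 - \<beta> \<bullet> sph x) powr (- a) \<partial>lborel)
         = p * (\<integral>x. \<phi> x * w x powr p * (1 - \<beta> \<bullet> sph x) powr (- b) \<partial>lborel)"
proof -
  define D where "D = 1 - norm \<beta> ^ 2"
  have D: "D > 0" using \<beta> by (simp add: D_def power_less_one_iff)
  define q where "q y = p * w y powr (p - 1) * \<phi> y" for y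
  define U where "U x = w x powr p * (1 - \<beta> \<bullet> sph x) powr (- a)" for x
  define H where "H y x = q y * (U x / ker y x)" for y x
  define V where "V y = D powr (- s) * w y * (1 - \<beta> \<bullet> sph y) powr (- b) / \<gamma>" for y
  have [measurable]: "q \<in> borel_measurable borel" "U \<in> borel_measurable borel"
    unfolding q_def U_def by measurable
  have U_int: "has_bochner_integral lborel (\<lambda>x. U x / ker y x) (V y)" for y
    using riesz_tilted[OF \<beta>, of y] by (simp add: U_def V_def D_def)
  have U_nonneg: "U x / ker y x \<ge> 0" for x y by (simp add: U_def ker_nonneg)
  \<comment> \<open>The factor \<open>w\<close> in \<open>V\<close> raises
    \<open>w powr (p - 1)\<close> to \<open>w powr p\<close>, so the product is a bounded multiple
    of an integrable function.\<close>
  have qV: "q y * V y = (p * D powr (- s) / \<gamma>) * (\<phi> y * (1 - \<beta> \<bullet> sph y) powr (- b) * w y powr p)" for y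
    using w_pos[of y] by (simp add: q_def V_def w_powr_diff)
  have int1: "integrable lborel (\<lambda>y. \<phi> y * (1 - \<beta> \<bullet> sph y) powr (- b) * w y powr p)"
  proof (rule integrable_bounded_mult_w_powr_p)
    have "C \<ge> 0" using bd[of 0] by simp
    then show "\<bar>\<phi> x * (1 - \<beta> \<bullet> sph x) powr (- b)\<bar> \<le> C * (1 - norm \<beta>) powr (- b)" for x
      unfolding abs_mult using bd abs_tilt_powr_le[OF \<beta> b_pos] by (intro mult_mono) auto
  qed measurable
  have "integrable (lborel \<Otimes>\<^sub>M lborel) (case_prod H)"
  proof (rule lborel_pair.Fubini_integrable)
    show "case_prod H \<in> borel_measurable (lborel \<Otimes>\<^sub>M lborel)"
      unfolding H_def by measurable
    show "AE y in lborel. integrable lborel (\<lambda>x. case_prod H (y, x))"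
      using U_int by (intro AE_I2) (simp add: H_def has_bochner_integral_iff del: times_divide_eq_right)
    \<comment> \<open>As \<open>U x / ker y x\<close> is nonnegative, the absolute value only meets
      \<open>q\<close>, and the inner integral is known exactly.\<close>
    have "(\<integral>x. norm (case_prod H (y, x)) \<partial>lborel) = \<bar>q y * V y\<bar>" for y
    proof -
      have "(\<integral>x. norm (case_prod H (y, x)) \<partial>lborel) = (\<integral>x. \<bar>q y\<bar> * (U x / ker y x) \<partial>lborel)"
        using U_nonneg by (simp only: H_def prod.case real_norm_def abs_mult abs_of_nonneg)
      also have "\<dots> = \<bar>q y\<bar> * V y"
        using U_int[of y] by (simp add: has_bochner_integral_iff del: times_divide_eq_right)
      also have "\<dots> = \<bar>q y * V y\<bar>" using w_pos[of y] \<gamma>_pos by (simp add: V_def abs_mult)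
      finally show ?thesis .
    qed
    then show "integrable lborel (\<lambda>y. \<integral>x. norm (case_prod H (y, x)) \<partial>lborel)"
      using int1 by (simp only: qV) (intro integrable_abs integrable_mult_right, simp)
  qed
  then have "(\<integral>x. (\<integral>y. H y x \<partial>lborel) \<partial>lborel) = (\<integral>y. (\<integral>x. H y x \<partial>lborel) \<partial>lborel)"
    by (rule lborel_pair.Fubini_integral)
  moreover have "(\<integral>y. H y x \<partial>lborel) = (\<phi> x * w x powr p * (1 - \<beta> \<bullet> sph x) powr (- a)) / \<gamma>" for x
  proof -
    have "(\<integral>y. H y x \<partial>lborel) = (\<integral>y. U x * (q y / ker x y) \<partial>lborel)"
      by (simp add: H_def ker_commute[of x] mult.commute)
    also have "\<dots> = U x * (\<integral>y. q y / ker x y \<partial>lborel)"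
      by (rule integral_mult_right_zero)
    also have "(\<integral>y. q y / ker x y \<partial>lborel) = \<phi> x / \<gamma>"
    proof -
      have "\<phi> x = \<gamma> * (\<integral>y. q y / ker x y \<partial>lborel)"
        using sol unfolding linearized_sol_iff q_def by blast
      then show ?thesis using \<gamma>_pos by (simp add: field_simps)
    qed
    finally show ?thesis by (simp add: U_def mult_ac)
  qed
  moreover have "(\<integral>x. H y x \<partial>lborel) = q y * V y" for y
    using U_int[of y] by (simp add: H_def has_bochner_integral_iff del: times_divide_eq_right)
  ultimately have "(\<integral>x. \<phi> x * w x powr p * (1 - \<beta> \<bullet> sph x) powr (- a) \<partial>lborel) / \<gamma>
      = (p * D powr (- s) / \<gamma>) * (\<integral>y. \<phi> y * (1 - \<beta> \<bullet> sph y) powr (- b) * w y powr p \<partial>lborel)"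
    by (simp only: qV integral_mult_right_zero integral_divide_zero)
  then show ?thesis
    using \<gamma>_pos D by (simp add: D_def[symmetric] powr_minus field_simps)
qed

text \<open>The tilted identity is linear in \<open>f\<close>; this abstract form is meant for the
  difference of the densities of two solutions. At \<open>\<beta> = t *\<^sub>R \<theta>\<close> the
  two integrals are power series in \<open>t\<close> whose coefficients are moments times rising
  factorials.\<close>

lemma sph_moments_eq_0:
  fixes \<theta> :: "'a \<times> real"
  assumes f: "integrable lborel f"
    and tilted: "\<And>\<beta>. norm \<beta> < 1 \<Longrightarrow>
      (1 - norm \<beta> ^ 2) powr s * (\<integral>x. f x * (1 - \<beta> \<bullet> sph x) powr (- a) \<partial>lborel)
        = p * (\<integral>x. f x * (1 - \<beta> \<bullet> sph x) powr (- b) \<partial>lborel)"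
    and first: "\<And>\<theta>. (\<integral>x. f x * (\<theta> \<bullet> sph x) \<partial>lborel) = 0" and \<theta>: "norm \<theta> \<le> 1"
  shows "(\<integral>x. f x * (\<theta> \<bullet> sph x) ^ k \<partial>lborel) = 0"
proof (induction k rule: less_induct)
  case (less k)
  define m where "m k = (\<integral>x. f x * (\<theta> \<bullet> sph x) ^ k \<partial>lborel)" for k
  have le: "\<bar>\<theta> \<bullet> sph x\<bar> \<le> 1" for x using abs_inner_sph_le[of \<theta> x] \<theta> by linarith
  have "pochhammer a k / fact k * m k = p * (pochhammer b k / fact k * m k)"
  proof (rule leading_coefficient_unique)
    fix t :: real
    assume t: "\<bar>t\<bar> < 1"
    show "(\<lambda>k. pochhammer a k / fact k * m k * t ^ k) sums (\<integral>x. f x * (1 - t * (\<theta> \<bullet> sph x)) powr (- a) \<partial>lborel)"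
      unfolding m_def by (rule sums_integral_pochhammer[OF f _ le t a_pos]) measurable
    have "(\<lambda>k. p * (pochhammer b k / fact k * m k * t ^ k)) sums
        (p * (\<integral>x. f x * (1 - t * (\<theta> \<bullet> sph x)) powr (- b) \<partial>lborel))"
      unfolding m_def by (intro sums_mult sums_integral_pochhammer[OF f _ le t b_pos]) measurable
    then show "(\<lambda>k. p * (pochhammer b k / fact k * m k) * t ^ k) sums
        (p * (\<integral>x. f x * (1 - t * (\<theta> \<bullet> sph x)) powr (- b) \<partial>lborel))"
      by (simp add: mult.assoc)
    have "norm (t *\<^sub>R \<theta>) < 1"
      using mult_left_mono[OF \<theta>, of "\<bar>t\<bar>"] t by simp
    from tilted[OF this]
    show "(1 - norm (t *\<^sub>R \<theta>) ^ 2) powr s * (\<integral>x. f x * (1 - t * (\<theta> \<bullet> sph x)) powr (- a) \<partial>lborel)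
        = p * (\<integral>x. f x * (1 - t * (\<theta> \<bullet> sph x)) powr (- b) \<partial>lborel)"
      by simp
  next
    show "((\<lambda>t. (1 - norm (t *\<^sub>R \<theta>) ^ 2) powr s) \<longlongrightarrow> 1) (at 0)"
      by (rule tendsto_eq_intros refl | simp)+
  qed (use less.IH in \<open>auto simp: m_def\<close>)
  then have "pochhammer a k * m k = p * pochhammer b k * m k" by simp
  then have eq: "pochhammer a k = p * pochhammer b k \<or> m k = 0" by auto
  show ?case
  proof (cases k)
    \<comment> \<open>Both rising factorials are 1 and \<open>p > 1\<close>, so the moment must
      vanish.\<close>
    case 0
    then show ?thesis using eq p_gt_1 by (simp add: m_def)
  next
    case (Suc j)
    show ?thesis
    proof (cases "j = 0")
      \<comment> \<open>For \<open>k = 1\<close>, \<open>pochhammer a k\<close> and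
        \<open>p * pochhammer b k\<close> both equal \<open>a\<close>. The comparison says nothing
        here, and \<open>first\<close> takes over.\<close>
      case True
      then show ?thesis using Suc first by simp
    next
      case False
      \<comment> \<open>Since \<open>p * b = a\<close>, the first factors agree, and the product of
        the remaining \<open>j\<close> factors is strictly larger for \<open>a\<close> than for
        \<open>b\<close>.\<close>
      have "pochhammer (b + 1) j < pochhammer (a + 1) j"
        using b_pos b_less_a False by (intro pochhammer_strict_mono) auto
      then have "a * pochhammer (b + 1) j < a * pochhammer (a + 1) j" using a_pos by simp
      moreover have "p * pochhammer b k = a * pochhammer (b + 1) j"
        by (simp add: Suc pochhammer_rec pb[symmetric])
      moreover have "pochhammer a k = a * pochhammer (a + 1) j"
        by (simp add: Suc pochhammer_rec)
      ultimately have "pochhammer a k \<noteq> p * pochhammer b k" by linarith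
      then show ?thesis using eq by (simp add: m_def)
    qed
  qed
qed

text \<open>This is the first order term in \<open>\<beta>\<close> of the equation for the tilted bubble. Passing to the odd part
in \<open>\<beta>\<close> removes the zeroth order term.\<close>

lemma linearized_sol_sph: "linearized_sol (\<lambda>x. w x * (v \<bullet> sph x))"
  unfolding linearized_sol_iff
proof
  fix x :: 'a
  define r where "r = norm v + 1"
  have r: "r > 0" by (simp add: r_def add_nonneg_pos)
  define \<theta> where "\<theta> = (1 / r) *\<^sub>R v"
  have \<theta>: "norm \<theta> \<le> 1" using r by (simp add: \<theta>_def r_def)
  have v: "v \<bullet> \<eta> = r * (\<theta> \<bullet> \<eta>)" for \<eta> using r by (simp add: \<theta>_def)
  have le: "\<bar>\<theta> \<bullet> sph x\<bar> \<le> 1" for x using abs_inner_sph_le[of \<theta> x] \<theta> by linarith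
  define g where "g y = w y powr p / ker x y" for y
  have g: "integrable lborel g" using riesz_w[of x] by (simp add: g_def[abs_def] has_bochner_integral_iff)
  define m where "m k = (\<integral>y. g y * (\<theta> \<bullet> sph y) ^ k \<partial>lborel)" for k
  define A where "A k = pochhammer b k / fact k * (w x * (\<theta> \<bullet> sph x) ^ k)" for k
  define B where "B k = \<gamma> * (pochhammer a k / fact k * m k)" for k
  define F where "F t = w x * (1 - t * (\<theta> \<bullet> sph x)) powr (- b)" for t
  define G where "G t = \<gamma> * (\<integral>y. g y * (1 - t * (\<theta> \<bullet> sph y)) powr (- a) \<partial>lborel)" for t
  have F: "(\<lambda>k. A k * t ^ k) sums F t" if "\<bar>t\<bar> < 1" for t
  proof -
    have "\<bar>t * (\<theta> \<bullet> sph x)\<bar> < 1"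
      using mult_left_mono[OF le[of x], of "\<bar>t\<bar>"] that by (simp add: abs_mult)
    from sums_mult[OF sums_pochhammer_powr[OF this, of b], of "w x"] show ?thesis
      by (simp add: A_def F_def power_mult_distrib mult_ac)
  qed
  have G: "(\<lambda>k. B k * t ^ k) sums G t" if "\<bar>t\<bar> < 1" for t
  proof -
    have "(\<lambda>k. \<gamma> * (pochhammer a k / fact k * m k * t ^ k)) sums G t"
      unfolding m_def G_def by (intro sums_mult sums_integral_pochhammer[OF g _ le that a_pos]) measurable
    then show ?thesis by (simp add: B_def mult.assoc)
  qed
  have odd_part: "(\<lambda>k. (A k * (1 - (- 1) ^ k)) * t ^ k) sums (F t - F (- t))"
    if F: "\<And>t. \<bar>t\<bar> < 1 \<Longrightarrow> (\<lambda>k. A k * t ^ k) sums F t" and t: "\<bar>t\<bar> < 1"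
    for A and F :: "real \<Rightarrow> real" and t
  proof -
    have "A k * t ^ k - A k * (- t) ^ k = (A k * (1 - (- 1) ^ k)) * t ^ k" for k
      using power_minus[of t k] by (simp add: algebra_simps)
    then show ?thesis using sums_diff[OF F[OF t] F[of "- t"]] t by simp
  qed
  have FG: "(1 - norm (t *\<^sub>R \<theta>) ^ 2) powr (- s) * F t = G t" if "\<bar>t\<bar> < 1" for t
  proof -
    have "norm (t *\<^sub>R \<theta>) < 1"
      using mult_left_mono[OF \<theta>, of "\<bar>t\<bar>"] that by simp
    from riesz_tilted[OF this, of x] show ?thesis
      using \<gamma>_pos by (simp add: F_def G_def g_def has_bochner_integral_iff)
  qed
  \<comment> \<open>The prefactor \<open>(1 - norm (t *\<^sub>R \<theta>) ^ 2) powr (- s)\<close> is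
    even in \<open>t\<close>, so the relation between \<open>F\<close> and \<open>G\<close> passes
    to their odd parts.\<close>
  have "A 1 * (1 - (- 1) ^ 1) = B 1 * (1 - (- 1) ^ 1)"
  proof (rule leading_coefficient_unique[OF odd_part[OF F] odd_part[OF G]])
    fix t :: real
    assume t: "\<bar>t\<bar> < 1"
    show "(1 - norm (t *\<^sub>R \<theta>) ^ 2) powr (- s) * (F t - F (- t)) = G t - G (- t)"
      using FG[OF t] FG[of "- t"] t by (simp add: right_diff_distrib)
  next
    show "((\<lambda>t. (1 - norm (t *\<^sub>R \<theta>) ^ 2) powr (- s)) \<longlongrightarrow> 1) (at 0)"
      by (rule tendsto_eq_intros refl | simp)+
  qed auto
  then have "b * (w x * (\<theta> \<bullet> sph x)) = \<gamma> * (a * m 1)"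
    by (simp add: A_def B_def)
  \<comment> \<open>Writing \<open>a\<close> as \<open>p * b\<close> and cancelling \<open>b\<close>
    turns the comparison of first order coefficients into the linearized equation.\<close>
  then have "b * (w x * (\<theta> \<bullet> sph x)) = b * (\<gamma> * (p * m 1))"
    by (simp add: pb[symmetric] mult_ac)
  then have eq: "w x * (\<theta> \<bullet> sph x) = \<gamma> * (p * m 1)" using b_pos by simp
  have "(\<integral>y. p * w y powr (p - 1) * (w y * (v \<bullet> sph y)) / ker x y \<partial>lborel)
      = (\<integral>y. (p * r) * (g y * (\<theta> \<bullet> sph y) ^ 1) \<partial>lborel)"
    using w_pos by (intro Bochner_Integration.integral_cong)
      (auto simp: g_def v w_powr_diff less_imp_neq[OF w_pos, symmetric])
  also have "\<dots> = p * r * m 1" unfolding m_def by (rule integral_mult_right_zero)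
  finally have *: "(\<integral>y. p * w y powr (p - 1) * (w y * (v \<bullet> sph y)) / ker x y \<partial>lborel) = p * r * m 1" .
  have "w x * (v \<bullet> sph x) = r * (\<gamma> * (p * m 1))" using eq by (simp add: v)
  also have "\<dots> = \<gamma> * (\<integral>y. p * w y powr (p - 1) * (w y * (v \<bullet> sph y)) / ker x y \<partial>lborel)"
    unfolding * by simp
  finally show "w x * (v \<bullet> sph x) = \<gamma> * (\<integral>y. p * w y powr (p - 1) * (w y * (v \<bullet> sph y)) / ker x y \<partial>lborel)" .
qed

section \<open>Correction of the first moments and classification\<close>

text \<open>The form sending \<open>v\<close> to the integral of
  \<open>w x * w x powr p * (v \<bullet> sph x) ^ 2\<close> is positive definite. Hence
  \<open>L\<close> is injective and, in finite dimension, surjective.\<close>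

lemma sph_first_moments_surj:
  fixes c :: "'a \<times> real"
  obtains v where "\<And>\<theta>. (\<integral>x. w x * (v \<bullet> sph x) * w x powr p * (\<theta> \<bullet> sph x) \<partial>lborel) = \<theta> \<bullet> c"
proof -
  define L where "L v = (\<integral>x. (w x * (v \<bullet> sph x) * w x powr p) *\<^sub>R sph x \<partial>lborel)" for v :: "'a \<times> real"
  have int0: "integrable lborel (\<lambda>x. w x * (v \<bullet> sph x) * w x powr p)" for v
  proof (rule integrable_bounded_mult_w_powr_p)
    show "\<bar>w x * (v \<bullet> sph x)\<bar> \<le> \<alpha> * norm v" for x
      unfolding abs_mult using w_pos[of x] w_le[of x] abs_inner_sph_le[of v x] \<alpha>_pos by (intro mult_mono) auto
  qed measurable
  have int: "integrable lborel (\<lambda>x. (w x * (v \<bullet> sph x) * w x powr p) *\<^sub>R sph x)" for v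
    by (rule Bochner_Integration.integrable_bound[OF int0[of v]]) auto
  have inner: "\<theta> \<bullet> L v = (\<integral>x. w x * (v \<bullet> sph x) * w x powr p * (\<theta> \<bullet> sph x) \<partial>lborel)" for \<theta> v
    unfolding L_def using integral_inner_right[of \<theta> lborel, OF int[of v]] by simp
  have "linear L"
  proof (rule linearI)
    show "L (u + v) = L u + L v" for u v
      unfolding L_def using int[of u] int[of v]
      by (simp add: inner_add_left distrib_left distrib_right scaleR_add_left)
    show "L (r *\<^sub>R v) = r *\<^sub>R L v" for r v
      unfolding L_def by (simp add: mult_ac flip: integral_scaleR_right)
  qed
  moreover have "inj L"
    unfolding linear_injective_0[OF \<open>linear L\<close>]
  proof (intro allI impI)
    fix v
    assume "L v = 0"
    then have "(\<integral>x. w x * (v \<bullet> sph x) * w x powr p * (v \<bullet> sph x) \<partial>lborel) = 0"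
      using inner[of v v] by simp
    moreover have "integrable lborel (\<lambda>x. w x * (v \<bullet> sph x) * w x powr p * (v \<bullet> sph x))"
      using integrable_inner_right[of v lborel, OF int[of v]] by simp
    moreover have nonneg: "0 \<le> w x * (v \<bullet> sph x) * w x powr p * (v \<bullet> sph x)" for x
    proof -
      have "w x * (v \<bullet> sph x) * w x powr p * (v \<bullet> sph x) = w x * w x powr p * (v \<bullet> sph x) ^ 2"
        by (simp add: power2_eq_square)
      also have "\<dots> \<ge> 0" using w_pos[of x] by simp
      finally show ?thesis .
    qed
    ultimately have "AE x in lborel. w x * (v \<bullet> sph x) * w x powr p * (v \<bullet> sph x) = 0"
      using integral_nonneg_eq_0_iff_AE by blast
    \<comment> \<open>A closed set of full measure is the whole space, so the relation will hold at
      every point.\<close>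
    then have "AE x in lebesgue. x \<in> {x. v \<bullet> sph x = 0}"
      using w_pos by (intro AE_completion) (auto simp: less_imp_neq[OF w_pos, symmetric])
    moreover have "closed {x. v \<bullet> sph x = 0}"
      by (intro closed_Collect_eq continuous_intros)
    ultimately have all: "v \<bullet> sph x = 0" for x
      using mem_closed_if_AE_lebesgue[of "{x. v \<bullet> sph x = 0}" x] by simp
    obtain v1 r where v: "v = (v1, r)" by (cases v)
    \<comment> \<open>The origin is sent to the pole \<open>(0, 1)\<close>, which isolates
      \<open>r\<close>; the point \<open>v1\<close> then tests \<open>v1\<close> against
      itself.\<close>
    have "r = 0" using all[of 0] by (simp add: v sph_def)
    then have "v1 \<bullet> v1 = 0" using all[of v1] by (simp add: v sph_def)
    then show "v = 0" using \<open>r = 0\<close> by (simp add: v zero_prod_def)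
  qed
  ultimately have "surj L" by (simp add: linear_injective_imp_surjective)
  then obtain v where "L v = c" by (metis surjD)
  then show thesis using inner[of _ v] by (intro that[of v]) simp
qed

text \<open>The Bochner integral of a non-measurable function is \<open>0\<close>, so the equation itself forces measurability.\<close>

lemma linearized_sol_measurable:
  assumes "linearized_sol \<phi>"
  shows "\<phi> \<in> borel_measurable borel"
proof (rule ccontr)
  assume non: "\<phi> \<notin> borel_measurable borel"
  have "\<phi> x = 0" for x
  proof -
    let ?q = "\<lambda>y. p * w y powr (p - 1) * \<phi> y / ker x y"
    have "\<not> integrable lborel ?q"
    proof
      assume "integrable lborel ?q"
      then have [measurable]: "?q \<in> borel_measurable borel" by auto
      \<comment> \<open>Away from \<open>y = x\<close>, multiplying \<open>?q\<close> by the kernel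
        recovers \<open>\<phi>\<close>. At \<open>y = x\<close> the kernel vanishes and erases the
        value, so it is prescribed separately.\<close>
      have "\<phi> = (\<lambda>y. if y = x then \<phi> x else ?q y * ker x y / (p * w y powr (p - 1)))"
        using w_pos p_gt_1 by (auto simp: fun_eq_iff ker_def less_imp_neq[OF w_pos, symmetric])
      also have "\<dots> \<in> borel_measurable borel" by measurable
      finally show False using non by contradiction
    qed
    then have "(\<integral>y. ?q y \<partial>lborel) = 0" by (rule not_integrable_integral_eq)
    moreover have "\<phi> x = \<gamma> * (\<integral>y. ?q y \<partial>lborel)"
      using assms unfolding linearized_sol_iff by blast
    ultimately show ?thesis by (simp only: mult_zero_right)
  qed
  then have "\<phi> = (\<lambda>_. 0)" by auto
  then show False using non by simp
qed

lemma linearized_sol_classification: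
  assumes "bounded (range \<phi>)" and sol: "linearized_sol \<phi>"
  obtains v where "\<And>x. \<phi> x = w x * (v \<bullet> sph x)"
proof -
  note [measurable] = linearized_sol_measurable[OF sol]
  obtain C where C: "\<And>x. \<bar>\<phi> x\<bar> \<le> C" using assms(1) by (auto simp: bounded_iff)
  have \<phi>_int: "integrable lborel (\<lambda>x. \<phi> x * w x powr p)"
    using C by (intro integrable_bounded_mult_w_powr_p) auto
  have \<phi>_int': "integrable lborel (\<lambda>x. (\<phi> x * w x powr p) *\<^sub>R sph x)"
    by (rule Bochner_Integration.integrable_bound[OF \<phi>_int]) auto
  \<comment> \<open>This \<open>v\<close> gives \<open>\<psi>\<close> below the same first moments
    as \<open>\<phi>\<close>.\<close>
  obtain v where v: "\<And>\<theta>. (\<integral>x. w x * (v \<bullet> sph x) * w x powr p * (\<theta> \<bullet> sph x) \<partial>lborel)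
      = \<theta> \<bullet> (\<integral>x. (\<phi> x * w x powr p) *\<^sub>R sph x \<partial>lborel)"
    using sph_first_moments_surj by blast
  define \<psi> where "\<psi> x = w x * (v \<bullet> sph x)" for x
  have [measurable]: "\<psi> \<in> borel_measurable borel" unfolding \<psi>_def by measurable
  have \<psi>: "\<bar>\<psi> x\<bar> \<le> \<alpha> * norm v" for x
    unfolding \<psi>_def abs_mult using w_pos[of x] w_le[of x] abs_inner_sph_le[of v x] \<alpha>_pos
    by (intro mult_mono) auto
  have \<psi>_sol: "linearized_sol \<psi>" unfolding \<psi>_def by (rule linearized_sol_sph)
  have \<psi>_int: "integrable lborel (\<lambda>x. \<psi> x * w x powr p)"
    using \<psi> by (intro integrable_bounded_mult_w_powr_p) auto
  define f where "f x = \<phi> x * w x powr p - \<psi> x * w x powr p" for x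
  have f_int: "integrable lborel f" unfolding f_def using \<phi>_int \<psi>_int by simp
  have split: "(\<integral>x. f x * h x \<partial>lborel)
      = (\<integral>x. \<phi> x * w x powr p * h x \<partial>lborel) - (\<integral>x. \<psi> x * w x powr p * h x \<partial>lborel)"
    if [measurable]: "h \<in> borel_measurable borel" and h: "\<And>x. \<bar>h x\<bar> \<le> B" for h B
  proof -
    note int = integrable_mult_bounded[of lborel _ h B, OF _ _ h]
    from int[OF \<phi>_int] int[OF \<psi>_int] show ?thesis by (simp add: f_def left_diff_distrib)
  qed
  have "AE x in lborel. f x = 0"
  proof (rule AE_eq_0_if_sph_moments_0[OF f_int], rule sph_moments_eq_0[OF f_int])
    fix \<beta> :: "'a \<times> real"
    assume \<beta>: "norm \<beta> < 1"
    show "(1 - norm \<beta> ^ 2) powr s * (\<integral>x. f x * (1 - \<beta> \<bullet> sph x) powr (- a) \<partial>lborel)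
        = p * (\<integral>x. f x * (1 - \<beta> \<bullet> sph x) powr (- b) \<partial>lborel)"
      using linearized_sol_tilted[OF _ C sol \<beta>] linearized_sol_tilted[OF _ \<psi> \<psi>_sol \<beta>]
      by (simp add: split[OF _ abs_tilt_powr_le[OF \<beta> a_pos]] split[OF _ abs_tilt_powr_le[OF \<beta> b_pos]]
          right_diff_distrib)
  next
    fix \<theta> :: "'a \<times> real"
    show "(\<integral>x. f x * (\<theta> \<bullet> sph x) \<partial>lborel) = 0"
      using integral_inner_right[of \<theta> lborel, OF \<phi>_int'] v[of \<theta>]
      by (subst split[OF _ abs_inner_sph_le]) (simp_all add: \<psi>_def)
  qed
  then have AE: "AE x in lborel. \<phi> x = \<psi> x"
    by eventually_elim (use w_pos in \<open>auto simp: f_def less_imp_neq[OF w_pos, symmetric]\<close>)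
  \<comment> \<open>The right-hand sides of the two integral equations do not see null sets, so the
    equality almost everywhere improves to every point.\<close>
  have "\<phi> x = \<psi> x" for x
  proof -
    have "(\<integral>y. p * w y powr (p - 1) * \<phi> y / ker x y \<partial>lborel)
        = (\<integral>y. p * w y powr (p - 1) * \<psi> y / ker x y \<partial>lborel)"
      using AE by (intro integral_cong_AE) auto
    moreover have "\<phi> x = \<gamma> * (\<integral>y. p * w y powr (p - 1) * \<phi> y / ker x y \<partial>lborel)"
      "\<psi> x = \<gamma> * (\<integral>y. p * w y powr (p - 1) * \<psi> y / ker x y \<partial>lborel)"
      using sol \<psi>_sol unfolding linearized_sol_iff by blast+
    ultimately show ?thesis by (simp only:)
  qed
  then show thesis using that[of v] by (simp add: \<psi>_def)
qed

text \<open>The vector \<open>(2 / (1 + norm x ^ 2)) *\<^sub>R x\<close> from the logarithmic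
  derivative is the first component of \<open>sph x\<close>. This links the partial derivatives of
  \<open>w\<close> to the functions \<open>w x * (v \<bullet> sph x)\<close>.\<close>

lemma frechet_derivative_w: "frechet_derivative w (at x) h = - b * w x * (fst (sph x) \<bullet> h)"
proof -
  have w: "w = (\<lambda>x. \<alpha> * (1 + x \<bullet> x) powr (- b))"
    by (simp add: fun_eq_iff w_eq' power2_norm_eq_inner powr_divide powr_minus_divide add_nonneg_nonneg)
  have "((\<lambda>x. \<alpha> * (1 + x \<bullet> x) powr (- b)) has_derivative
      (\<lambda>h. - b * w x * (fst (sph x) \<bullet> h))) (at x)"
    by (rule derivative_eq_intros refl | simp add: add_pos_nonneg)+
      (simp add: fun_eq_iff w sph_def power2_norm_eq_inner inner_commute field_simps)
  then have "(w has_derivative (\<lambda>h. - b * w x * (fst (sph x) \<bullet> h))) (at x)"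
    by (simp only: w[symmetric])
  from frechet_derivative_at[OF this] show ?thesis by metis
qed

end

theorem theorem1:
  fixes s \<alpha> p :: real and w \<phi> :: "'a::euclidean_space \<Rightarrow> real"
  assumes "0 < s" "s < 1" "real DIM('a) > 2 * s"
    and "p = (real DIM('a) + 2 * s) / (real DIM('a) - 2 * s)"
    and "\<alpha> > 0"
    and "\<And>x. w x = \<alpha> * (1 / (1 + norm x ^ 2)) powr ((real DIM('a) - 2 * s) / 2)"
    and "frac_lap_sol s w (\<lambda>y. w y powr p)"
    and "bounded (range \<phi>)"
    and "frac_lap_sol s \<phi> (\<lambda>y. p * w y powr (p - 1) * \<phi> y)"
  shows "\<exists>c0 (c :: 'a \<Rightarrow> real). \<forall>x.
           \<phi> x = c0 * ((real DIM('a) - 2 * s) / 2 * w x + frechet_derivative w (at x) x)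
                 + (\<Sum>i\<in>Basis. c i * frechet_derivative w (at x) i)"
proof -
  interpret bubble s \<alpha> p w
    by unfold_locales (use assms in auto)
  have "linearized_sol \<phi>" using assms(9) unfolding linearized_sol_def .
  with assms(8) obtain v where v: "\<And>x. \<phi> x = w x * (v \<bullet> sph x)"
    using linearized_sol_classification by blast
  \<comment> \<open>The partial derivatives are \<open>- b * w x\<close> times the coordinates of
    \<open>fst (sph x)\<close>, and the dilation term is \<open>b * w x * snd (sph x)\<close>;
    matching with \<open>w x * (v \<bullet> sph x)\<close> gives the coefficients.\<close>
  have "\<phi> x = (snd v / b) * (b * w x + frechet_derivative w (at x) x)
      + (\<Sum>i\<in>Basis. (- (fst v \<bullet> i) / b) * frechet_derivative w (at x) i)" for x
  proof -
    have "snd (sph x) = 1 - fst (sph x) \<bullet> x"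
      by (simp add: sph_def power2_norm_eq_inner[symmetric] field_simps)
    then have "b * w x + frechet_derivative w (at x) x = b * w x * snd (sph x)"
      unfolding frechet_derivative_w by (simp add: right_diff_distrib)
    then have "(snd v / b) * (b * w x + frechet_derivative w (at x) x) = w x * (snd v * snd (sph x))"
      using b_pos by simp
    moreover have "(\<Sum>i\<in>Basis. (- (fst v \<bullet> i) / b) * frechet_derivative w (at x) i)
        = w x * (fst v \<bullet> fst (sph x))"
    proof -
      have "fst v \<bullet> fst (sph x) = (\<Sum>i\<in>Basis. (fst v \<bullet> i) * (fst (sph x) \<bullet> i))"
        by (rule euclidean_inner)
      then show ?thesis
        unfolding frechet_derivative_w using b_pos by (simp add: sum_distrib_left mult_ac)
    qed
    ultimately show ?thesis
      by (simp add: v inner_prod_def distrib_left)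
  qed
  then show ?thesis
    unfolding b_def
    by (intro exI[of _ "snd v / ((real DIM('a) - 2 * s) / 2)"]
        exI[of _ "\<lambda>i. - (fst v \<bullet> i) / ((real DIM('a) - 2 * s) / 2)"]) blast
qed

end
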